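(* Let $P$ be a stochastic matrix indexed by $\mathbb F$ such that: (i) $P$ has the block form $$P=\begin{pmatrix}\boldsymbol B(0)&\boldsymbol B(1)&\boldsymbol B(2)&\cdots\\ \boldsymbol B(-1)&\boldsymbol A(0)&\boldsymbol A(1)&\cdots\\ \boldsymbol B(-2)&\boldsymbol A(-1)&\boldsymbol A(0)&\cdots\\ \vdots&\vdots&\vdots&\ddots\end{pmatrix}$$ with $d\times d$ matrices $\boldsymbol A(k),\boldsymbol B(k)$ ($k\in\mathbb Z$); (ii) $P\in\mathsf{BM}_d$; (iii) $P$ is irreducible and positive recurrent, with stationary probability vector $\pi$; (iv) $\boldsymbol A:=\sum_{k=-\infty}^{\infty}\boldsymbol A(k)$ is irreducible and stochastic; (v) $r_{A_+}:=\sup\{z>0:\sum_{k=0}^\infty z^k\boldsymbol A(k)\text{ is finite}\}>1$. Suppose further that $\boldsymbol B(-k)=\boldsymbol A(-k)=\boldsymbol O$ for $k\ge2$, $\boldsymbol B(-1)=\boldsymbol A(-1)$, and $\boldsymbol B(k)=\boldsymbol A(k-1)$ for $k\in\mathbb Z_+$. Let $\alpha\in(1,r_{A_+})$ be such that $\delta_A(\alpha)<1$, and set $$\gamma=\delta_A(\alpha),\qquad b=(\alpha-1)\max_{i\in\mathbb D}v_A(\alpha,i),\qquad v(k,i)=\alpha^kv_A(\alpha,i)\quad((k,i)\in\mathbb F).$$ Then for all $n\in\mathbb N$ and all $m\in\mathbb N$, $$\left\|{}_{(n)}\pi_n-\pi\right\|\le \frac{b}{1-\gamma}\left(4\gamma^m+2m\sum_{i\in\mathbb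 D}\frac{1}{v(n,i)}\right).$$
   Context: Notation: $\mathbb N=\{1,2,\dots\}$, $\mathbb Z_+=\{0,1,2,\dots\}$, $d\in\mathbb N$, $\mathbb D=\{1,\dots,d\}$, $\mathbb F=\mathbb Z_+\times\mathbb D$. Inequalities are entrywise; $e$ is the column vector of ones, $\boldsymbol O$ the zero matrix. $P=(p(k,i;l,j))_{(k,i),(l,j)\in\mathbb F}$ and $P(k;l)=(p(k,i;l,j))_{i,j\in\mathbb D}$ is its $(k,l)$ block; the block form means $P(0;l)=\boldsymbol B(l)$ for $l\ge0$, $P(k;0)=\boldsymbol B(-k)$ for $k\ge1$, and $P(k;l)=\boldsymbol A(l-k)$ for $k,l\ge1$. $P\in\mathsf{BM}_d$ (block-monotone with block size $d$) means $\sum_{m\ge l}p(k,i;m,j)\le\sum_{m\ge l}p(k+1,i;m,j)$ for all $k,l\in\mathbb Z_+$, $i,j\in\mathbb D$. Let $r_{A_-}=\sup\{z>0:\sum_{k=1}^\infty z^k\boldsymbol A(-k)\text{ is finite}\}\ge1$ and $\mathcal I_A=(1/r_{A_-},r_{A_+})\cup\{1\}$. For $z\in\mathcal I_A$, $\widehat{\boldsymbol A}(z)=\sum_{k=-\infty}^\infty z^k\boldsymbol A(k)$; $\delta_A(z)$ is the real, maximum-modulus (Perron–Frobenius) eigenvalue of $\widehat{\boldsymbol A}(z)$; and $v_A(z)=(v_A(z,i))_{i\in\mathbb D}$ is a corresponding right eigenvector, $\widehat{\boldsymbol A}(z)v_A(z)=\delta_A(z)v_A(z)$, normalized so that $v_A(z)\ge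 e$. (Under hypotheses (i)–(v), an $\alpha\in(1,r_{A_+})$ with $\delta_A(\alpha)<1$ exists.) For $n\in\mathbb N$, the last-column-block-augmented truncation ${}_{(n)}P_n=({}_{(n)}p_n(k,i;l,j))$ of $P$ is the stochastic matrix indexed by $\mathbb F$ with ${}_{(n)}p_n(k,i;l,j)=p(k,i;l,j)$ for $l\le n-1$, ${}_{(n)}p_n(k,i;n,j)=\sum_{m\ge n}p(k,i;m,j)$, and ${}_{(n)}p_n(k,i;l,j)=0$ for $l>n$. ${}_{(n)}\pi_n$ denotes a stationary probability vector of ${}_{(n)}P_n$. $\|x\|=\sum_{(k,i)\in\mathbb F}|x(k,i)|$. *)

theory Defs
  imports "HOL-Analysis.Analysis"
begin

definition stochastic :: "('s \<Rightarrow> 's \<Rightarrow> real) \<Rightarrow> bool" where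
  "stochastic M \<longleftrightarrow> (\<forall>x y. 0 \<le> M x y) \<and> (\<forall>x. (M x has_sum 1) UNIV)"

primrec mat_power :: "('s \<Rightarrow> 's \<Rightarrow> real) \<Rightarrow> nat \<Rightarrow> 's \<Rightarrow> 's \<Rightarrow> real" where
  "mat_power M 0 x y = (if x = y then 1 else 0)"
| "mat_power M (Suc n) x y = (\<Sum>\<^sub>\<infinity>z\<in>UNIV. M x z * mat_power M n z y)"

definition irreducible_matrix :: "('s \<Rightarrow> 's \<Rightarrow> real) \<Rightarrow> bool" where
  "irreducible_matrix M \<longleftrightarrow> (\<forall>x y. \<exists>n. 0 < mat_power M n x y)"

text \<open>\<open>first_passage P n x y\<close> is the probability that the chain started in \<open>x\<close> visits \<open>y\<close>
  at time \<open>n\<close> for the first time at or after time 1.\<close>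
fun first_passage :: "('s \<Rightarrow> 's \<Rightarrow> real) \<Rightarrow> nat \<Rightarrow> 's \<Rightarrow> 's \<Rightarrow> real" where
  "first_passage P 0 x y = 0"
| "first_passage P (Suc 0) x y = P x y"
| "first_passage P (Suc (Suc n)) x y =
     (\<Sum>\<^sub>\<infinity>z\<in>-{y}. P x z * first_passage P (Suc n) z y)"

definition positive_recurrent :: "('s \<Rightarrow> 's \<Rightarrow> real) \<Rightarrow> bool" where
  "positive_recurrent P \<longleftrightarrow>
     (\<forall>x. (\<lambda>n. first_passage P n x x) sums 1 \<and>
          summable (\<lambda>n. real n * first_passage P n x x))"

definition stationary_distribution :: "('s \<Rightarrow> 's \<Rightarrow> real) \<Rightarrow> ('s \<Rightarrow> real) \<Rightarrow> bool" where
  "stationary_distribution P \<pi> \<longleftrightarrow>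
     (\<forall>x. 0 \<le> \<pi> x) \<and> (\<pi> has_sum 1) UNIV \<and>
     (\<forall>y. ((\<lambda>x. \<pi> x * P x y) has_sum \<pi> y) UNIV)"

text \<open>The set of phases (of cardinality \<open>d\<close>) is the finite type \<open>'d\<close>, and a state is a pair of a
  level and a phase.\<close>
type_synonym 'd state = "nat \<times> 'd"

definition block_form ::
  "('d::finite state \<Rightarrow> 'd state \<Rightarrow> real) \<Rightarrow> (int \<Rightarrow> real^'d^'d) \<Rightarrow> (int \<Rightarrow> real^'d^'d) \<Rightarrow> bool" where
  "block_form P A B \<longleftrightarrow>
     (\<forall>l i j. P (0, i) (l, j) = B (int l) $ i $ j) \<and>
     (\<forall>k\<ge>1. \<forall>i j. P (k, i) (0, j) = B (- int k) $ i $ j) \<and>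
     (\<forall>k\<ge>1. \<forall>l\<ge>1. \<forall>i j. P (k, i) (l, j) = A (int l - int k) $ i $ j)"

definition block_monotone :: "('d state \<Rightarrow> 'd state \<Rightarrow> real) \<Rightarrow> bool" where
  "block_monotone P \<longleftrightarrow>
     (\<forall>k l i j. (\<Sum>\<^sub>\<infinity>m\<in>{l..}. P (k, i) (m, j)) \<le> (\<Sum>\<^sub>\<infinity>m\<in>{l..}. P (Suc k, i) (m, j)))"

text \<open>The last-column-block-augmented truncation, kept as a matrix on the full state space.\<close>
fun LCBA_truncation ::
  "nat \<Rightarrow> ('d state \<Rightarrow> 'd state \<Rightarrow> real) \<Rightarrow> 'd state \<Rightarrow> 'd state \<Rightarrow> real" where
  "LCBA_truncation n P (k, i) (l, j) =
     (if l < n then P (k, i) (l, j)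
      else if l = n then (\<Sum>\<^sub>\<infinity>m\<in>{n..}. P (k, i) (m, j))
      else 0)"

text \<open>The supremum may be infinite.\<close>
definition r_plus :: "(int \<Rightarrow> real^'d^'d) \<Rightarrow> ereal" where
  "r_plus A = Sup {ereal z | z. 0 < z \<and> (\<forall>i j. summable (\<lambda>k. z ^ k * A (int k) $ i $ j))}"

definition A_hat :: "(int \<Rightarrow> real^'d^'d) \<Rightarrow> real \<Rightarrow> real^'d^'d" where
  "A_hat A z = (\<chi> i j. \<Sum>\<^sub>\<infinity>k\<in>UNIV. z powi k * A k $ i $ j)"

definition complex_eigenvalue :: "real^'d^'d \<Rightarrow> complex \<Rightarrow> bool" where
  "complex_eigenvalue M \<mu> \<longleftrightarrow>
     (\<exists>x :: complex^'d. x \<noteq> 0 \<and> (\<chi> i j. complex_of_real (M $ i $ j)) *v x = \<mu> *s x)"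

text \<open>The real eigenvalue that dominates all complex eigenvalues in modulus; such an eigenvalue
  is unique, and by Perron--Frobenius it exists for every nonnegative matrix.\<close>
definition PF_eigenvalue :: "real^'d^'d \<Rightarrow> real" where
  "PF_eigenvalue M =
     (THE r. complex_eigenvalue M (complex_of_real r) \<and>
             (\<forall>\<mu>. complex_eigenvalue M \<mu> \<longrightarrow> cmod \<mu> \<le> r))"

definition delta :: "(int \<Rightarrow> real^'d^'d) \<Rightarrow> real \<Rightarrow> real" where
  "delta A z = PF_eigenvalue (A_hat A z)"

text \<open>The normalization \<open>v \<ge> e\<close> does not determine the eigenvector, so this is a predicate.\<close>
definition normalized_PF_vector :: "(int \<Rightarrow> real^'d^'d) \<Rightarrow> real \<Rightarrow> real^'d \<Rightarrow> bool" where
  "normalized_PF_vector A z v \<longleftrightarrow> A_hat A z *v v = delta A z *\<^sub>R v \<and> (\<forall>i. 1 \<le> v $ i)"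

end

theory Submission
  imports Defs
begin

text \<open>Under the hypotheses every row block of \<open>P\<close> is a shift of the first one, so \<open>P\<close> and its
  truncation are driven by the same Markov-additive increments: \<open>k\<close> goes to \<open>max k 1 - 1 + t\<close>, capped
  at \<open>n\<close> for the truncation. In this representation \<open>v\<close> satisfies the drift condition
  \<open>P v \<le> \<gamma> v + b 1\<close> with \<open>1\<close> the indicator of level \<open>0\<close>, which bounds \<open>\<pi> v\<close> by \<open>b / (1 - \<gamma>)\<close> for either
  stationary vector. Both stationary vectors have the same phase marginal, and starting at level \<open>0\<close>
  with that marginal each chain is within \<open>2 \<gamma>\<^sup>m b / (1 - \<gamma>)\<close> of stationarity after \<open>m\<close> steps, by
  monotone coalescence. After \<open>m\<close> steps the two chains differ by at most \<open>2 m\<close> times the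
  stationary probability of exceeding level \<open>n\<close>, which Markov's inequality for \<open>v\<close> controls.
  All coupling arguments are carried out on test functions.\<close>

section \<open>Probability weights and means of test functions\<close>

definition weights :: "('s \<Rightarrow> real) \<Rightarrow> bool" where
  "weights q \<longleftrightarrow> (\<forall>x. 0 \<le> q x) \<and> (q has_sum 1) UNIV"

definition mean :: "('s \<Rightarrow> real) \<Rightarrow> ('s \<Rightarrow> real) \<Rightarrow> real" where
  "mean q f = (\<Sum>\<^sub>\<infinity>x\<in>UNIV. q x * f x)"

lemma summable_on_bounded_mult:
  fixes q f :: "'s \<Rightarrow> real"
  assumes "q summable_on A" "bounded (f ` A)"
  shows "(\<lambda>x. q x * f x) summable_on A"
proof -
  obtain C where C: "\<bar>f x\<bar> \<le> C" if "x \<in> A" for x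
    using assms(2) by (auto simp: bounded_iff)
  have "(\<lambda>x. norm (\<bar>C\<bar> * q x)) summable_on A"
    using assms(1) by (intro summable_on_iff_abs_summable_on_real[THEN iffD1] summable_on_cmult_right)
  then have "(\<lambda>x. norm (q x * f x)) summable_on A"
  proof (rule Infinite_Sum.abs_summable_on_comparison_test)
    fix x assume "x \<in> A"
    then have "\<bar>f x\<bar> \<le> \<bar>C\<bar>" using C by fastforce
    then show "norm (q x * f x) \<le> norm (\<bar>C\<bar> * q x)"
      by (simp add: abs_mult mult.commute mult_right_mono)
  qed
  then show ?thesis
    using summable_on_iff_abs_summable_on_real by blast
qed

lemma weights_nonneg: "weights q \<Longrightarrow> 0 \<le> q x"
  by (simp add: weights_def)

lemma weights_summable: "weights q \<Longrightarrow> q summable_on UNIV"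
  by (auto simp: weights_def has_sum_imp_summable)

lemma mean_summable:
  assumes "weights q" "bounded (range f)"
  shows "(\<lambda>x. q x * f x) summable_on UNIV"
  using assms by (intro summable_on_bounded_mult weights_summable)

lemma mean_const: "weights q \<Longrightarrow> mean q (\<lambda>_. c) = c"
  by (simp add: mean_def weights_def infsum_cmult_left' infsumI)

lemma mean_cmult: "mean q (\<lambda>x. c * f x) = c * mean q f"
proof -
  have "(\<lambda>x. q x * (c * f x)) = (\<lambda>x. c * (q x * f x))" by (simp add: fun_eq_iff)
  then show ?thesis by (simp add: mean_def infsum_cmult_right')
qed

lemma mean_add:
  assumes "(\<lambda>x. q x * f x) summable_on UNIV" "(\<lambda>x. q x * g x) summable_on UNIV"
  shows "mean q (\<lambda>x. f x + g x) = mean q f + mean q g"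
  using infsum_add[OF assms] by (simp add: mean_def algebra_simps)

lemma mean_diff:
  assumes "(\<lambda>x. q x * f x) summable_on UNIV" "(\<lambda>x. q x * g x) summable_on UNIV"
  shows "mean q (\<lambda>x. f x - g x) = mean q f - mean q g"
proof -
  have "(\<lambda>x. q x * (- 1 * g x)) summable_on UNIV"
    using assms(2) by (simp add: summable_on_uminus)
  from mean_add[OF assms(1) this] show ?thesis
    using mean_cmult[of q "- 1" g] by simp
qed

lemma summable_weighted_sum:
  fixes q :: "'s \<Rightarrow> real"
  assumes "finite I" "\<And>i. i \<in> I \<Longrightarrow> (\<lambda>x. q x * f i x) summable_on A"
  shows "(\<lambda>x. q x * (\<Sum>i\<in>I. f i x)) summable_on A"
  using assms by (induction I) (auto simp: distrib_left summable_on_add)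

lemma mean_sum:
  assumes "finite I" "\<And>i. i \<in> I \<Longrightarrow> (\<lambda>x. q x * f i x) summable_on UNIV"
  shows "mean q (\<lambda>x. \<Sum>i\<in>I. f i x) = (\<Sum>i\<in>I. mean q (f i))"
  using assms
proof (induction I)
  case empty
  then show ?case by (simp add: mean_def)
next
  case (insert i I)
  have "(\<lambda>x. q x * (\<Sum>i\<in>I. f i x)) summable_on UNIV"
    using insert.hyps(1) insert.prems by (intro summable_weighted_sum) auto
  with insert show ?case by (simp add: mean_add)
qed

lemma mean_mono:
  assumes "\<And>x. 0 \<le> q x"
    and "(\<lambda>x. q x * f x) summable_on UNIV" "(\<lambda>x. q x * g x) summable_on UNIV"
    and "\<And>x. f x \<le> g x"
  shows "mean q f \<le> mean q g"
  unfolding mean_def using assms by (intro infsum_mono) (auto intro: mult_left_mono)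

lemma abs_mean_le:
  assumes "\<And>x. 0 \<le> q x" "(\<lambda>x. q x * g x) summable_on UNIV" "\<And>x. \<bar>f x\<bar> \<le> g x"
  shows "\<bar>mean q f\<bar> \<le> mean q g"
proof -
  have "(\<lambda>x. norm (q x * f x)) summable_on UNIV"
    using assms by (intro summable_on_comparison_test[OF assms(2)])
      (auto simp: abs_mult intro: mult_left_mono)
  then have "(\<lambda>x. q x * f x) summable_on UNIV"
    using summable_on_iff_abs_summable_on_real by blast
  then show ?thesis
    unfolding mean_def
    using norm_infsum_le[OF has_sum_infsum has_sum_infsum[OF assms(2)], of "\<lambda>x. q x * f x"] assms
    by (auto simp: abs_mult intro: mult_left_mono)
qed

lemma bounded_rangeI: "(\<And>x. \<bar>f x\<bar> \<le> C) \<Longrightarrow> bounded (range f)" for f :: "'s \<Rightarrow> real"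
  by (auto simp: bounded_iff)

lemma abs_mean_le_const:
  assumes "weights q" "\<And>x. \<bar>f x\<bar> \<le> C"
  shows "\<bar>mean q f\<bar> \<le> C"
  using abs_mean_le[of q "\<lambda>_. C" f] assms mean_summable[of q "\<lambda>_. C"]
  by (simp add: weights_nonneg mean_const bounded_rangeI[of _ "\<bar>C\<bar>"])

text \<open>The fibres of \<open>h\<close> partition the space, so \<open>snd\<close> maps their
  disjoint union bijectively onto it and the sum can be taken fibre by fibre.\<close>

lemma has_sum_fibres:
  fixes g :: "'s \<Rightarrow> real"
  assumes "g summable_on UNIV"
  shows "((\<lambda>y. \<Sum>\<^sub>\<infinity>x\<in>h -` {y}. g x) has_sum infsum g UNIV) UNIV"
proof -
  let ?S = "SIGMA y:UNIV. h -` {y}"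
  have bij: "bij_betw snd ?S UNIV"
    by (rule bij_betwI[of _ _ _ "\<lambda>x. (h x, x)"]) auto
  have "((\<lambda>p. g (snd p)) has_sum infsum g UNIV) ?S"
    using has_sum_reindex_bij_betw[OF bij, of g] assms by simp
  then show ?thesis
    by (rule has_sum_Sigma') (use assms in \<open>auto intro: has_sum_infsum summable_on_subset\<close>)
qed

text \<open>Change of variables. It is applied with \<open>h\<close> capping the level at
  \<open>n\<close>, where the image weights are a row of the truncation.\<close>

lemma mean_pushforward:
  assumes "weights q" "bounded (range f)"
  shows "mean q (\<lambda>x. f (h x)) = mean (\<lambda>y. \<Sum>\<^sub>\<infinity>x\<in>h -` {y}. q x) f"
proof -
  have "range (\<lambda>x. f (h x)) \<subseteq> range f" by auto
  then have "(\<lambda>x. q x * f (h x)) summable_on UNIV"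
    using assms bounded_subset mean_summable by blast
  from infsumI[OF has_sum_fibres[OF this, of h]]
  have "mean q (\<lambda>x. f (h x)) = (\<Sum>\<^sub>\<infinity>y\<in>UNIV. \<Sum>\<^sub>\<infinity>x\<in>h -` {y}. q x * f (h x))"
    by (simp add: mean_def)
  also have "\<dots> = (\<Sum>\<^sub>\<infinity>y\<in>UNIV. (\<Sum>\<^sub>\<infinity>x\<in>h -` {y}. q x) * f y)"
  proof (rule infsum_cong)
    fix y
    have "(\<Sum>\<^sub>\<infinity>x\<in>h -` {y}. q x * f (h x)) = (\<Sum>\<^sub>\<infinity>x\<in>h -` {y}. q x * f y)"
      by (rule infsum_cong) auto
    then show "(\<Sum>\<^sub>\<infinity>x\<in>h -` {y}. q x * f (h x)) = (\<Sum>\<^sub>\<infinity>x\<in>h -` {y}. q x) * f y"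
      by (simp add: infsum_cmult_left')
  qed
  finally show ?thesis by (simp add: mean_def)
qed

lemma weights_pushforward:
  assumes "weights q"
  shows "weights (\<lambda>y. \<Sum>\<^sub>\<infinity>x\<in>h -` {y}. q x)"
  unfolding weights_def
proof (intro conjI allI)
  show "0 \<le> (\<Sum>\<^sub>\<infinity>x\<in>h -` {y}. q x)" for y
    using assms by (intro infsum_nonneg) (simp add: weights_nonneg)
  show "((\<lambda>y. \<Sum>\<^sub>\<infinity>x\<in>h -` {y}. q x) has_sum 1) UNIV"
    using has_sum_fibres[OF weights_summable[OF assms], of h] assms
    by (auto simp: weights_def dest: infsumI)
qed

section \<open>Stationary vectors: averaged balance equations, and uniqueness on a finite
  space\<close>

text \<open>Stationarity is given entry by entry. Boundedness of \<open>f\<close> makes the double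
  family summable, so the two sums may be exchanged.\<close>

lemma stationary_mean:
  assumes K: "\<And>x. weights (K x)" and st: "stationary_distribution K \<mu>"
    and f: "bounded (range f)"
  shows "mean \<mu> (\<lambda>x. mean (K x) f) = mean \<mu> f"
proof -
  obtain C where C: "\<bar>f x\<bar> \<le> C" for x
    using f by (auto simp: bounded_iff)
  have w: "weights \<mu>" using st by (simp add: stationary_distribution_def weights_def)
  have sK: "(\<lambda>(x, y). \<mu> x * K x y) summable_on UNIV \<times> UNIV"
  proof (rule summable_on_SigmaI[where g = \<mu>])
    show "((\<lambda>y. case (x, y) of (x, y) \<Rightarrow> \<mu> x * K x y) has_sum \<mu> x) UNIV" for x
      using has_sum_cmult_right[of "K x" UNIV 1 "\<mu> x"] K[of x] by (simp add: weights_def)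
    show "\<mu> summable_on UNIV" using w by (rule weights_summable)
  qed (use weights_nonneg[OF w] weights_nonneg[OF K] in auto)
  have "(\<lambda>p. (case p of (x, y) \<Rightarrow> \<mu> x * K x y) * f (snd p)) summable_on UNIV \<times> UNIV"
    using C by (intro summable_on_bounded_mult[OF sK]) (auto simp: bounded_iff)
  then have s: "(\<lambda>(x, y). \<mu> x * K x y * f y) summable_on UNIV \<times> UNIV"
    by (simp add: case_prod_unfold)
  have "mean \<mu> (\<lambda>x. mean (K x) f) = (\<Sum>\<^sub>\<infinity>x\<in>UNIV. \<Sum>\<^sub>\<infinity>y\<in>UNIV. \<mu> x * K x y * f y)"
    by (simp add: mean_def mult.assoc infsum_cmult_right')
  also have "\<dots> = (\<Sum>\<^sub>\<infinity>y\<in>UNIV. \<Sum>\<^sub>\<infinity>x\<in>UNIV. \<mu> x * K x y * f y)"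
    by (rule infsum_swap_banach[OF s])
  also have "\<dots> = (\<Sum>\<^sub>\<infinity>y\<in>UNIV. \<mu> y * f y)"
    using st infsumI by (fastforce simp: infsum_cmult_left' stationary_distribution_def
        intro!: infsum_cong)
  finally show ?thesis by (simp add: mean_def)
qed

text \<open>The positive and negative parts of the difference of two stationary vectors are again
  stationary, and irreducibility makes each of them vanish everywhere or nowhere.\<close>

lemma stationary_unique_finite:
  fixes M :: "'d::finite \<Rightarrow> 'd \<Rightarrow> real"
  assumes M: "stochastic M" and irr: "irreducible_matrix M"
    and p: "\<And>j. (\<Sum>i\<in>UNIV. p i * M i j) = p j" and q: "\<And>j. (\<Sum>i\<in>UNIV. q i * M i j) = q j"
    and pq: "sum p UNIV = sum q UNIV"
  shows "p = q"
proof -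
  have M0: "0 \<le> M i j" for i j using M by (simp add: stochastic_def)
  have M1: "(\<Sum>j\<in>UNIV. M i j) = 1" for i
    using M by (simp add: stochastic_def has_sum_finite_iff)
  define r where "r i = p i - q i" for i
  have r: "(\<Sum>i\<in>UNIV. r i * M i j) = r j" for j
    using p q by (simp add: r_def left_diff_distrib sum_subtractf)
  have pos: "(\<forall>j. w j = 0) \<or> (\<forall>j. 0 < w j)"
    if w0: "\<And>j. 0 \<le> w j" and w: "\<And>j. (\<Sum>i\<in>UNIV. w i * M i j) = w j" for w
  proof (cases "\<exists>i. w i \<noteq> 0")
    case True
    then obtain i where i: "0 < w i" using w0 by (metis less_eq_real_def)
    have wn: "(\<Sum>i\<in>UNIV. w i * mat_power M n i j) = w j" for n j
    proof (induction n)
      case (Suc n)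
      have "(\<Sum>i\<in>UNIV. w i * mat_power M (Suc n) i j)
          = (\<Sum>k\<in>UNIV. \<Sum>i\<in>UNIV. w i * M i k * mat_power M n k j)"
        by (subst sum.swap) (simp add: sum_distrib_left mult.assoc)
      also have "\<dots> = (\<Sum>k\<in>UNIV. w k * mat_power M n k j)"
        by (simp add: sum_distrib_right[symmetric] w)
      finally show ?case using Suc by simp
    qed (simp add: if_distrib[of "(*) _"] cong: if_cong)
    have mp: "0 \<le> mat_power M n k j" for n k j
      by (induction n arbitrary: k) (auto intro!: sum_nonneg mult_nonneg_nonneg M0)
    have "0 < w j" for j
    proof -
      obtain n where n: "0 < mat_power M n i j" using irr by (auto simp: irreducible_matrix_def)
      have "0 < w i * mat_power M n i j" using i n by simp
      also have "\<dots> \<le> (\<Sum>i\<in>UNIV. w i * mat_power M n i j)"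
        by (rule member_le_sum) (auto intro!: mult_nonneg_nonneg w0 mp)
      finally show ?thesis by (simp add: wn)
    qed
    then show ?thesis by blast
  qed auto
  \<comment> \<open>Triangle inequality. Unit row sums give both sides the same total over
    \<open>j\<close>, so equality holds in every entry and the absolute value of \<open>r\<close> is
    stationary too.\<close>
  have le: "\<bar>r j\<bar> \<le> (\<Sum>i\<in>UNIV. \<bar>r i\<bar> * M i j)" for j
    by (subst r[symmetric]) (rule order_trans[OF sum_abs], simp add: abs_mult M0)
  have "(\<Sum>j\<in>UNIV. \<Sum>i\<in>UNIV. \<bar>r i\<bar> * M i j) = (\<Sum>i\<in>UNIV. \<bar>r i\<bar>)"
    by (subst sum.swap) (simp add: sum_distrib_left[symmetric] M1)
  then have "(\<Sum>j\<in>UNIV. (\<Sum>i\<in>UNIV. \<bar>r i\<bar> * M i j) - \<bar>r j\<bar>) = 0"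
    by (simp add: sum_subtractf)
  then have ra: "(\<Sum>i\<in>UNIV. \<bar>r i\<bar> * M i j) = \<bar>r j\<bar>" for j
    using le by (subst (asm) sum_nonneg_eq_0_iff) auto
  have a: "(\<forall>j. \<bar>r j\<bar> + r j = 0) \<or> (\<forall>j. 0 < \<bar>r j\<bar> + r j)"
    by (rule pos) (auto simp: distrib_right sum.distrib r ra)
  have b: "(\<forall>j. \<bar>r j\<bar> - r j = 0) \<or> (\<forall>j. 0 < \<bar>r j\<bar> - r j)"
    by (rule pos) (auto simp: left_diff_distrib sum_subtractf r ra)
  have s0: "sum r UNIV = 0" using pq by (simp add: r_def sum_subtractf)
  \<comment> \<open>At any index one of the two vectors vanishes, so they are not both strictly
    positive; one is identically zero, and \<open>r\<close> has a constant sign.\<close>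
  have "(\<forall>j. 0 \<le> r j) \<or> (\<forall>j. 0 \<le> - r j)"
    using a b by (smt (verit))
  then have "r j = 0" for j
  proof
    assume "\<forall>j. 0 \<le> r j"
    then show ?thesis using s0 by (simp add: sum_nonneg_eq_0_iff)
  next
    assume "\<forall>j. 0 \<le> - r j"
    then show ?thesis using s0 sum_nonneg_eq_0_iff[of UNIV "\<lambda>j. - r j"] by (simp add: sum_negf)
  qed
  then show ?thesis by (simp add: r_def fun_eq_iff)
qed

section \<open>Walks with Markov-additive increments and a level cap\<close>

definition marginal :: "('d::finite state \<Rightarrow> real) \<Rightarrow> 'd \<Rightarrow> real" where
  "marginal \<mu> i = mean \<mu> (\<lambda>x. of_bool (snd x = i))"

lemma mean_marginal:
  assumes "weights \<mu>"
  shows "mean \<mu> (\<lambda>x. g (snd x)) = (\<Sum>i\<in>UNIV. marginal \<mu> i * g i)"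
proof -
  have s: "(\<lambda>x. \<mu> x * (g i * of_bool (snd x = i))) summable_on UNIV" for i
    using assms by (intro mean_summable bounded_rangeI[of _ "\<bar>g i\<bar>"]) auto
  have "mean \<mu> (\<lambda>x. g (snd x)) = mean \<mu> (\<lambda>x. \<Sum>i\<in>UNIV. g i * of_bool (snd x = i))"
    by (simp add: of_bool_def if_distrib[of "(*) _"] cong: if_cong)
  also have "\<dots> = (\<Sum>i\<in>UNIV. mean \<mu> (\<lambda>x. g i * of_bool (snd x = i)))"
    by (rule mean_sum) (use s in auto)
  finally show ?thesis by (simp add: mean_cmult marginal_def mult.commute)
qed

text \<open>With the kernel of the increment \<open>(t, j)\<close> given the phase \<open>i\<close>, the level moves from \<open>k\<close> to
  \<open>k - 1 + t\<close>. Truncated subtraction sends level \<open>0\<close> to where level \<open>1\<close> goes, which is exactly the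
  boundary behaviour of the chain.\<close>

locale level_walk =
  fixes a :: "'d::finite \<Rightarrow> 'd state \<Rightarrow> real"
  assumes a_weights: "weights (a i)"
begin

text \<open>The transition operator on functions, with \<open>c\<close> applied to the new level:
  \<open>id\<close> gives the chain, \<open>min n\<close> its truncation. Both read the same
  increments, which is the coupling.\<close>

definition step :: "(nat \<Rightarrow> nat) \<Rightarrow> ('d state \<Rightarrow> real) \<Rightarrow> 'd state \<Rightarrow> real" where
  "step c f x = mean (a (snd x)) (\<lambda>y. f (c (fst x - 1 + fst y), snd y))"

text \<open>Stationarity tested on bounded functions, so that no transition matrix has to be written
  down for the capped walk.\<close>

definition invariant :: "(nat \<Rightarrow> nat) \<Rightarrow> ('d state \<Rightarrow> real) \<Rightarrow> bool" where
  "invariant c \<mu> \<longleftrightarrow> weights \<mu> \<and> (\<forall>f. bounded (range f) \<longrightarrow> mean \<mu> (step c f) = mean \<mu> f)"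

definition phase_matrix :: "'d \<Rightarrow> 'd \<Rightarrow> real" where
  "phase_matrix i j = mean (a i) (\<lambda>y. of_bool (snd y = j))"

lemma a_summable:
  "bounded (range f) \<Longrightarrow> (\<lambda>y. a i y * f (h y)) summable_on UNIV"
  by (rule mean_summable[OF a_weights]) (auto intro: bounded_subset)

lemma step_bound: "(\<And>x. \<bar>f x\<bar> \<le> C) \<Longrightarrow> \<bar>step c f x\<bar> \<le> C"
  unfolding step_def by (rule abs_mean_le_const[OF a_weights])

lemma steps_bound: "(\<And>x. \<bar>f x\<bar> \<le> C) \<Longrightarrow> \<bar>(step c ^^ m) f x\<bar> \<le> C"
  by (induction m arbitrary: x) (auto intro: step_bound)

lemma bounded_steps: "bounded (range f) \<Longrightarrow> bounded (range ((step c ^^ m) f))"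
  by (metis bounded_rangeI bounded_iff range_eqI real_norm_def steps_bound)

lemma invariant_steps:
  assumes "invariant c \<mu>" "bounded (range f)"
  shows "mean \<mu> ((step c ^^ m) f) = mean \<mu> f"
proof (induction m)
  case (Suc m)
  have "mean \<mu> (step c ((step c ^^ m) f)) = mean \<mu> ((step c ^^ m) f)"
    using assms bounded_steps by (simp add: invariant_def)
  with Suc show ?case by simp
qed simp

text \<open>Both starting levels receive the same increment and new phase, and their order survives
  truncated subtraction and a monotone cap.\<close>

lemma step_mono_level:
  assumes f: "bounded (range f)" "\<And>k l i. k \<le> l \<Longrightarrow> f (k, i) \<le> f (l, i)"
    and "k \<le> l" "mono c"
  shows "step c f (k, i) \<le> step c f (l, i)"
  unfolding step_def fst_conv snd_conv
proof (rule mean_mono)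
  have "k - 1 + t \<le> l - 1 + t" for t using \<open>k \<le> l\<close> by simp
  then show "f (c (k - 1 + fst y), snd y) \<le> f (c (l - 1 + fst y), snd y)" for y
    by (intro f(2) monoD[OF \<open>mono c\<close>])
qed (use f(1) in \<open>auto simp: weights_nonneg[OF a_weights] intro: a_summable\<close>)

lemma steps_mono_level:
  assumes f: "bounded (range f)" "\<And>k l i. k \<le> l \<Longrightarrow> f (k, i) \<le> f (l, i)"
    and "k \<le> l" "mono c"
  shows "(step c ^^ m) f (k, i) \<le> (step c ^^ m) f (l, i)"
  using \<open>k \<le> l\<close>
  by (induction m arbitrary: k l i) (auto intro!: f step_mono_level bounded_steps \<open>mono c\<close>)

text \<open>The phase moves on its own: on a phase indicator, \<open>step c\<close> depends neither
  on the level nor on the cap.\<close>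

lemma marginal_invariant:
  assumes "invariant c \<mu>"
  shows "(\<Sum>i\<in>UNIV. marginal \<mu> i * phase_matrix i j) = marginal \<mu> j"
proof -
  let ?f = "\<lambda>x::'d state. of_bool (snd x = j) :: real"
  have "step c ?f = (\<lambda>x. phase_matrix (snd x) j)"
    by (simp add: fun_eq_iff step_def phase_matrix_def)
  moreover have "mean \<mu> (step c ?f) = mean \<mu> ?f"
    using assms bounded_rangeI[of ?f 1] by (simp add: invariant_def)
  moreover have "weights \<mu>" using assms by (simp add: invariant_def)
  ultimately show ?thesis
    using mean_marginal[of \<mu> "\<lambda>i. phase_matrix i j"] by (simp add: marginal_def)
qed

lemma stochastic_phase_matrix: "stochastic phase_matrix"
proof -
  have "(\<Sum>j\<in>UNIV. phase_matrix i j) = 1" for i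
    using mean_marginal[OF a_weights, of i "\<lambda>_. 1"] mean_const[OF a_weights, of i 1]
    by (simp add: phase_matrix_def marginal_def)
  moreover have "0 \<le> phase_matrix i j" for i j
    unfolding phase_matrix_def mean_def
    by (intro infsum_nonneg) (simp add: weights_nonneg[OF a_weights])
  ultimately show ?thesis by (simp add: stochastic_def has_sum_finite_iff)
qed

text \<open>Both marginals are fixed by the same irreducible \<open>phase_matrix\<close>, whatever
  the caps. Hence the two chains can be started from one common law on level 0.\<close>

lemma marginal_unique:
  assumes "irreducible_matrix phase_matrix" "invariant c \<mu>" "invariant c' \<nu>"
  shows "marginal \<mu> = marginal \<nu>"
proof (rule stationary_unique_finite[OF stochastic_phase_matrix assms(1)])
  have "sum (marginal \<mu>) UNIV = 1" if "weights \<mu>" for \<mu> :: "'d state \<Rightarrow> real"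
    using mean_marginal[OF that, of "\<lambda>_. 1"] mean_const[OF that, of 1] by simp
  then show "sum (marginal \<mu>) UNIV = sum (marginal \<nu>) UNIV"
    using assms by (simp add: invariant_def)
qed (use assms marginal_invariant in auto)

text \<open>The two chains agree along the same increments until the untruncated one exceeds level \<open>n\<close>.\<close>

lemma steps_truncation_diff:
  assumes f: "\<And>x. \<bar>f x\<bar> \<le> 1"
  shows "\<bar>(step id ^^ m) f x - (step (min n) ^^ m) f x\<bar>
    \<le> 2 * (\<Sum>s<m. (step id ^^ Suc s) (\<lambda>y. of_bool (n < fst y)) x)"
proof (induction m arbitrary: x)
  case (Suc m)
  let ?H = "\<lambda>y::'d state. of_bool (n < fst y) :: real"
  let ?g = "(step id ^^ m) f" and ?g' = "(step (min n) ^^ m) f"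
  let ?R = "\<lambda>x. 2 * (\<Sum>s<Suc m. (step id ^^ s) ?H x)"
  have H: "bounded (range ?H)" by (rule bounded_rangeI[of _ 1]) auto
  have H0: "0 \<le> (step id ^^ s) ?H x" for s x
    by (induction s arbitrary: x)
      (auto simp: step_def mean_def intro!: infsum_nonneg mult_nonneg_nonneg weights_nonneg[OF a_weights])
  have bf: "bounded (range f)" using f by (rule bounded_rangeI)
  \<comment> \<open>Split on the level after the first move. Up to \<open>n\<close> the capped walk
    is in the same state and the induction hypothesis applies; above \<open>n\<close> the term
    \<open>s = 0\<close> of \<open>?R\<close> already pays for the trivial bound 2.\<close>
  have le: "\<bar>?g (l, j) - ?g' (min n l, j)\<bar> \<le> ?R (l, j)" for l j
  proof (cases "l \<le> n")
    case True
    then have "?R (l, j) = 2 * (\<Sum>s<m. (step id ^^ Suc s) ?H (l, j))"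
      unfolding sum.lessThan_Suc_shift by simp
    then show ?thesis
      using Suc.IH[of "(l, j)"] by (simp only: min_absorb2[OF True])
  next
    case False
    have "\<bar>?g (l, j) - ?g' (min n l, j)\<bar> \<le> 2"
      using steps_bound[of f, OF f, of m id "(l, j)"] steps_bound[of f, OF f, of m "min n" "(min n l, j)"]
      by linarith
    also have "\<dots> \<le> ?R (l, j)"
      using False unfolding sum.lessThan_Suc_shift
      by (simp add: sum_nonneg H0 del: funpow.simps)
    finally show ?thesis .
  qed
  let ?d = "\<lambda>y. ?g (fst x - 1 + fst y, snd y) - ?g' (min n (fst x - 1 + fst y), snd y)"
  let ?S = "\<lambda>y. \<Sum>s<Suc m. (step id ^^ s) ?H (fst x - 1 + fst y, snd y)"
  have sH: "(\<lambda>y. a (snd x) y * (step id ^^ s) ?H (fst x - 1 + fst y, snd y)) summable_on UNIV" for s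
    by (rule a_summable[OF bounded_steps[OF H]])
  have sS: "(\<lambda>y. a (snd x) y * ?S y) summable_on UNIV"
    by (rule summable_weighted_sum) (simp_all only: finite_lessThan sH)
  have s2: "(\<lambda>y. a (snd x) y * (2 * ?S y)) summable_on UNIV"
    using summable_on_cmult_right[OF sS, of 2] by (simp only: mult.left_commute)
  have eq: "(step id ^^ Suc m) f x - (step (min n) ^^ Suc m) f x = mean (a (snd x)) ?d"
    by (subst mean_diff)
      (auto simp: step_def intro!: a_summable[OF bounded_steps[OF bf]])
  have abs_le: "\<bar>mean (a (snd x)) ?d\<bar> \<le> mean (a (snd x)) (\<lambda>y. 2 * ?S y)"
  proof (rule abs_mean_le)
    show "0 \<le> a (snd x) y" for y by (rule weights_nonneg[OF a_weights])
    show "\<bar>?d y\<bar> \<le> 2 * ?S y" for y using le[of "fst x - 1 + fst y" "snd y"] .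
  qed (rule s2)
  have "mean (a (snd x)) ?S
      = (\<Sum>s<Suc m. mean (a (snd x)) (\<lambda>y. (step id ^^ s) ?H (fst x - 1 + fst y, snd y)))"
    by (rule mean_sum) (simp_all only: finite_lessThan sH)
  also have "\<dots> = (\<Sum>s<Suc m. (step id ^^ Suc s) ?H x)"
    by (rule sum.cong) (simp_all add: step_def)
  finally have "mean (a (snd x)) (\<lambda>y. 2 * ?S y) = 2 * (\<Sum>s<Suc m. (step id ^^ Suc s) ?H x)"
    unfolding mean_cmult by (rule arg_cong)
  then show ?case using abs_le unfolding eq by (simp only:)
qed simp

end

section \<open>Geometric drift: contraction, moment bound and truncation error\<close>

text \<open>A move from level \<open>Suc k\<close> leads to \<open>k + t\<close>, and a move from
  level 0 to \<open>t\<close>; these are the arguments of \<open>v\<close> in the two drift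
  conditions, and \<open>b\<close> is charged at level 0 only.\<close>

locale drift_walk = level_walk +
  fixes v :: "'a state \<Rightarrow> real" and \<gamma> b :: real
  assumes v_ge: "1 \<le> v x"
    and v_mono: "k \<le> l \<Longrightarrow> v (k, i) \<le> v (l, i)"
    and v_summable: "(\<lambda>y. a i y * v (k + fst y, snd y)) summable_on UNIV"
    and drift_Suc: "mean (a i) (\<lambda>y. v (k + fst y, snd y)) \<le> \<gamma> * v (Suc k, i)"
    and drift_0: "mean (a i) v \<le> \<gamma> * v (0, i) + b"
    and \<gamma>_nonneg: "0 \<le> \<gamma>" and \<gamma>_less: "\<gamma> < 1" and b_nonneg: "0 \<le> b"
begin

text \<open>Driven by the same increments, two copies of the chain in the same phase keep their order and
  merge at the latest when the upper one reaches level \<open>0\<close>.\<close>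

lemma steps_contraction:
  assumes f: "\<And>x. \<bar>f x\<bar> \<le> 1" and c: "mono c" "\<And>l. c l \<le> l" and "k' \<le> k"
  shows "\<bar>(step c ^^ m) f (k, i) - (step c ^^ m) f (k', i)\<bar> \<le> 2 * \<gamma> ^ m * v (k, i)"
  using \<open>k' \<le> k\<close>
proof (induction m arbitrary: k k' i)
  case 0
  then show ?case using f[of "(k, i)"] f[of "(k', i)"] v_ge[of "(k, i)"] by simp
next
  case (Suc m)
  let ?g = "(step c ^^ m) f"
  have bf: "bounded (range f)" using f by (rule bounded_rangeI)
  show ?case
  proof (cases k)
    \<comment> \<open>Here \<open>k'\<close> is 0 as well: the copies have merged and the difference
      is zero. Level 0 is never charged, so \<open>b\<close> does not enter the contraction.\<close>
    case 0
    have "0 \<le> v (k, i)" using v_ge[of "(k, i)"] by linarith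
    then show ?thesis using 0 Suc.prems \<gamma>_nonneg by simp
  next
    case k: (Suc r)
    have "(step c ^^ Suc m) f (k, i) - (step c ^^ Suc m) f (k', i) =
      mean (a i) (\<lambda>y. ?g (c (r + fst y), snd y) - ?g (c (k' - 1 + fst y), snd y))"
      by (subst mean_diff) (auto simp: step_def k intro!: a_summable[OF bounded_steps[OF bf]])
    also have "\<bar>\<dots>\<bar> \<le> mean (a i) (\<lambda>y. 2 * \<gamma> ^ m * v (r + fst y, snd y))"
    proof (rule abs_mean_le)
      show "0 \<le> a i y" for y by (rule weights_nonneg[OF a_weights])
      show "(\<lambda>y. a i y * (2 * \<gamma> ^ m * v (r + fst y, snd y))) summable_on UNIV"
        using summable_on_cmult_right[OF v_summable, of "2 * \<gamma> ^ m"]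
        by (simp add: mult.left_commute mult.assoc)
      fix y :: "'a state"
      \<comment> \<open>By truncated subtraction \<open>k' - 1\<close> is at most \<open>r\<close>
        even for \<open>k' = 0\<close>.\<close>
      have "c (k' - 1 + fst y) \<le> c (r + fst y)"
        using Suc.prems k by (intro monoD[OF c(1)]) auto
      then have "\<bar>?g (c (r + fst y), snd y) - ?g (c (k' - 1 + fst y), snd y)\<bar>
          \<le> 2 * \<gamma> ^ m * v (c (r + fst y), snd y)"
        by (rule Suc.IH)
      also have "\<dots> \<le> 2 * \<gamma> ^ m * v (r + fst y, snd y)"
        using \<gamma>_nonneg by (intro mult_left_mono v_mono c) auto
      finally show "\<bar>?g (c (r + fst y), snd y) - ?g (c (k' - 1 + fst y), snd y)\<bar>
          \<le> 2 * \<gamma> ^ m * v (r + fst y, snd y)" .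
    qed
    also have "\<dots> \<le> 2 * \<gamma> ^ m * (\<gamma> * v (k, i))"
      unfolding mean_cmult k using \<gamma>_nonneg by (intro mult_left_mono drift_Suc) auto
    finally show ?thesis by (simp add: mult.assoc mult.left_commute)
  qed
qed

text \<open>Since \<open>v\<close> is not known to be integrable, the drift inequality is averaged for the bounded
  function \<open>min v N\<close> instead.\<close>

lemma invariant_v:
  assumes inv: "invariant c \<mu>" and c: "\<And>l. c l \<le> l"
  shows "(\<lambda>x. \<mu> x * v x) summable_on UNIV" and "mean \<mu> v \<le> b / (1 - \<gamma>)"
proof -
  have w: "weights \<mu>" using inv by (simp add: invariant_def)
  have v0: "0 \<le> v x" for x using v_ge[of x] by linarith
  have fin: "(\<Sum>x\<in>F. \<mu> x * v x) \<le> b / (1 - \<gamma>)" if "finite F" for F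
  proof -
    obtain N where N: "v x \<le> N" if "x \<in> F" for x
      using finite_imageI[OF \<open>finite F\<close>, of v] bdd_above_finite[of "v ` F"]
      by (auto simp: bdd_above_def)
    \<comment> \<open>\<open>M\<close> dominates \<open>v\<close> on \<open>F\<close>, so the caps
      in \<open>w1\<close> and \<open>w2\<close> are inactive on \<open>F\<close>, while both
      functions are bounded everywhere.\<close>
    define M where "M = max 0 N"
    have M: "0 \<le> M" "\<And>x. x \<in> F \<Longrightarrow> v x \<le> M" using N by (auto simp: M_def le_max_iff_disj)
    define w1 where "w1 x = min (v x) M" for x
    define w2 where "w2 x = min (\<gamma> * v x) M" for x
    have b1: "bounded (range w1)" and b2: "bounded (range w2)"
      using v0 M(1) \<gamma>_nonneg by (auto simp: w1_def w2_def intro!: bounded_rangeI[of _ M])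
    have b3: "bounded (range (\<lambda>x. w2 x + b))"
      using v0 M(1) \<gamma>_nonneg b_nonneg by (auto simp: w2_def intro!: bounded_rangeI[of _ "M + b"])
    have b4: "bounded (range (step c w1))"
      using bounded_steps[OF b1, of 1 c] by simp
    have st: "step c w1 (k, i) \<le> w2 (k, i) + b" for k i
    proof -
      have "step c w1 (k, i) \<le> mean (a i) (\<lambda>y. v (k - 1 + fst y, snd y))"
        unfolding step_def fst_conv snd_conv
      proof (rule mean_mono)
        show "w1 (c (k - 1 + fst y), snd y) \<le> v (k - 1 + fst y, snd y)" for y
          by (simp add: w1_def min.coboundedI1 v_mono c)
      qed (use b1 in \<open>auto intro: a_summable[OF b1] v_summable simp: weights_nonneg[OF a_weights]\<close>)
      also have "\<dots> \<le> \<gamma> * v (k, i) + b"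
        \<comment> \<open>At level 0, \<open>k - 1\<close> is 0 and \<open>drift_0\<close> applies;
          elsewhere adding \<open>b\<close> only weakens \<open>drift_Suc\<close>.\<close>
        using drift_0[of i] drift_Suc[of i "k - 1"] b_nonneg by (cases k) auto
      finally have "step c w1 (k, i) \<le> \<gamma> * v (k, i) + b" .
      moreover have "step c w1 (k, i) \<le> M"
        using step_bound[of w1 M c "(k, i)"] v0 M(1) by (auto simp: w1_def)
      ultimately show ?thesis using b_nonneg by (auto simp: w2_def min_def)
    qed
    have "mean \<mu> w1 = mean \<mu> (step c w1)"
      using inv b1 by (simp add: invariant_def)
    also have "\<dots> \<le> mean \<mu> (\<lambda>x. w2 x + b)"
      by (rule mean_mono) (use w b3 b4 st in \<open>auto intro: mean_summable weights_nonneg\<close>)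
    also have "\<dots> = mean \<mu> w2 + b"
      using w b2 by (subst mean_add) (auto simp: mean_const intro: mean_summable bounded_rangeI)
    finally have "mean \<mu> w1 - mean \<mu> w2 \<le> b" by simp
    then have "mean \<mu> (\<lambda>x. w1 x - w2 x) \<le> b"
      using w b1 b2 by (subst mean_diff) (auto intro: mean_summable)
    \<comment> \<open>Nonnegativity of \<open>w1 - w2\<close> allows the states outside
      \<open>F\<close> to be dropped; on \<open>F\<close> the difference is
      \<open>v x * (1 - \<gamma>)\<close>.\<close>
    moreover have w12: "w2 x \<le> w1 x" for x
      using mult_right_mono[of \<gamma> 1 "v x"] \<gamma>_less v0[of x] by (simp add: w1_def w2_def min.coboundedI1)
    moreover have "(\<Sum>x\<in>F. \<mu> x * (w1 x - w2 x)) \<le> mean \<mu> (\<lambda>x. w1 x - w2 x)"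
      unfolding mean_def
    proof (rule finite_sum_le_infsum)
      show "(\<lambda>x. \<mu> x * (w1 x - w2 x)) summable_on UNIV"
        using w b1 b2 by (intro mean_summable bounded_minus_comp) auto
    qed (use \<open>finite F\<close> w12 weights_nonneg[OF w] in auto)
    moreover have "(\<Sum>x\<in>F. \<mu> x * (w1 x - w2 x)) = (\<Sum>x\<in>F. \<mu> x * v x * (1 - \<gamma>))"
    proof (rule sum.cong)
      fix x assume "x \<in> F"
      have "\<gamma> * v x \<le> v x" using mult_right_mono[of \<gamma> 1 "v x"] \<gamma>_less v0[of x] by simp
      then have "w1 x - w2 x = v x * (1 - \<gamma>)"
        using M(2)[OF \<open>x \<in> F\<close>] by (simp add: w1_def w2_def algebra_simps)
      then show "\<mu> x * (w1 x - w2 x) = \<mu> x * v x * (1 - \<gamma>)" by simp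
    qed simp
    ultimately have "(\<Sum>x\<in>F. \<mu> x * v x) * (1 - \<gamma>) \<le> b"
      by (simp add: sum_distrib_right)
    then show ?thesis using \<gamma>_less by (simp add: field_simps)
  qed
  show s: "(\<lambda>x. \<mu> x * v x) summable_on UNIV"
  proof (rule nonneg_bdd_above_summable_on)
    show "bdd_above (sum (\<lambda>x. \<mu> x * v x) ` {F. F \<subseteq> UNIV \<and> finite F})"
      using fin by (intro bdd_aboveI2[of _ _ "b / (1 - \<gamma>)"]) auto
  qed (use v0 weights_nonneg[OF w] in auto)
  show "mean \<mu> v \<le> b / (1 - \<gamma>)"
    unfolding mean_def by (rule infsum_le_finite_sums[OF s]) (use fin in auto)
qed

text \<open>Invariance replaces \<open>f\<close> by its \<open>m\<close>-step mean. Moving each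
  start down to level 0 in its own phase costs at most \<open>2 * \<gamma> ^ m * v x\<close>, whose
  mean \<open>invariant_v\<close> bounds.\<close>

lemma invariant_convergence:
  assumes inv: "invariant c \<mu>" and f: "\<And>x. \<bar>f x\<bar> \<le> 1" and c: "mono c" "\<And>l. c l \<le> l"
  shows "\<bar>mean \<mu> f - (\<Sum>i\<in>UNIV. marginal \<mu> i * (step c ^^ m) f (0, i))\<bar> \<le> 2 * \<gamma> ^ m * (b / (1 - \<gamma>))"
proof -
  let ?g = "(step c ^^ m) f"
  have w: "weights \<mu>" using inv by (simp add: invariant_def)
  have bf: "bounded (range f)" using f by (rule bounded_rangeI)
  have bg0: "bounded (range (\<lambda>x. ?g (0, snd x)))"
    using steps_bound[OF f] by (rule bounded_rangeI)
  have "mean \<mu> f - (\<Sum>i\<in>UNIV. marginal \<mu> i * ?g (0, i)) = mean \<mu> ?g - mean \<mu> (\<lambda>x. ?g (0, snd x))"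
    using mean_marginal[OF w, of "\<lambda>i. ?g (0, i)"] invariant_steps[OF inv bf] by simp
  also have "\<dots> = mean \<mu> (\<lambda>x. ?g x - ?g (0, snd x))"
    by (rule mean_diff[symmetric]) (use w bf bg0 in \<open>auto intro: mean_summable bounded_steps\<close>)
  also have "\<bar>\<dots>\<bar> \<le> mean \<mu> (\<lambda>x. 2 * \<gamma> ^ m * v x)"
  proof (rule abs_mean_le)
    show "0 \<le> \<mu> x" for x using w by (rule weights_nonneg)
    show "(\<lambda>x. \<mu> x * (2 * \<gamma> ^ m * v x)) summable_on UNIV"
      using summable_on_cmult_right[OF invariant_v(1)[OF inv c(2)], of "2 * \<gamma> ^ m"]
      by (simp add: mult.left_commute mult.assoc)
    show "\<bar>?g x - ?g (0, snd x)\<bar> \<le> 2 * \<gamma> ^ m * v x" for x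
      using steps_contraction[of f, OF f c, of 0 "fst x" m "snd x"] by simp
  qed
  also have "\<dots> \<le> 2 * \<gamma> ^ m * (b / (1 - \<gamma>))"
    unfolding mean_cmult using \<gamma>_nonneg invariant_v(2)[OF inv c(2)] by (intro mult_left_mono) auto
  finally show ?thesis .
qed

text \<open>Markov's inequality: above level \<open>n\<close> the ratio
  \<open>v x / v (n, snd x)\<close> is at least 1. Summing the reciprocals over all phases makes the
  factor constant, leaving only \<open>mean \<mu> v\<close>.\<close>

lemma invariant_tail:
  assumes inv: "invariant id \<mu>"
  shows "mean \<mu> (\<lambda>x. of_bool (n < fst x)) \<le> b / (1 - \<gamma>) * (\<Sum>i\<in>UNIV. 1 / v (n, i))"
proof -
  let ?S = "\<Sum>i\<in>UNIV. 1 / v (n, i)"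
  have w: "weights \<mu>" using inv by (simp add: invariant_def)
  have v0: "0 < v x" for x using v_ge[of x] by linarith
  have S0: "0 \<le> ?S" using v0 by (intro sum_nonneg) (simp add: less_imp_le)
  have "mean \<mu> (\<lambda>x. of_bool (n < fst x)) \<le> mean \<mu> (\<lambda>x. ?S * v x)"
  proof (rule mean_mono)
    show "(\<lambda>x. \<mu> x * of_bool (n < fst x)) summable_on UNIV"
      using w by (intro mean_summable bounded_rangeI[of _ 1]) auto
    show "(\<lambda>x. \<mu> x * (?S * v x)) summable_on UNIV"
      using summable_on_cmult_right[OF invariant_v(1)[OF inv], of ?S] by (simp add: mult.left_commute)
    fix x :: "'a state"
    show "of_bool (n < fst x) \<le> ?S * v x"
    proof (cases "n < fst x")
      case True
      have "1 / v (n, snd x) \<le> ?S"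
        using v0 by (intro member_le_sum) (auto simp: less_imp_le)
      then have "1 / v (n, snd x) * v x \<le> ?S * v x"
        using v0[of x] by (intro mult_right_mono) auto
      moreover have "v (n, snd x) \<le> v x"
        using v_mono[of n "fst x" "snd x"] True by simp
      then have "1 \<le> 1 / v (n, snd x) * v x" using v0 by (simp add: field_simps)
      ultimately show ?thesis using True by simp
    qed (use S0 v0[of x] in \<open>simp add: less_imp_le\<close>)
  qed (use weights_nonneg[OF w] in auto)
  also have "\<dots> \<le> ?S * (b / (1 - \<gamma>))"
    unfolding mean_cmult using S0 invariant_v(2)[OF inv] by (intro mult_left_mono) auto
  finally show ?thesis by (simp add: mult.commute)
qed

text \<open>The gap is at most twice the expected number of times from 1 to \<open>m\<close> spent
  above \<open>n\<close>. Raising the start from level 0 to that of \<open>x\<close> increases this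
  number, and then invariance makes all \<open>m\<close> terms equal to the stationary tail.\<close>

lemma invariant_truncation_diff:
  assumes inv: "invariant id \<mu>" and f: "\<And>x. \<bar>f x\<bar> \<le> 1"
  shows "\<bar>(\<Sum>i\<in>UNIV. marginal \<mu> i * ((step id ^^ m) f (0, i) - (step (min n) ^^ m) f (0, i)))\<bar>
    \<le> 2 * real m * (b / (1 - \<gamma>) * (\<Sum>i\<in>UNIV. 1 / v (n, i)))"
proof -
  let ?H = "\<lambda>y::'a state. of_bool (n < fst y) :: real"
  let ?D = "\<lambda>x. (step id ^^ m) f (0, snd x) - (step (min n) ^^ m) f (0, snd x)"
  have w: "weights \<mu>" using inv by (simp add: invariant_def)
  have H: "bounded (range ?H)" by (rule bounded_rangeI[of _ 1]) auto
  have sH: "(\<lambda>x. \<mu> x * (step id ^^ Suc s) ?H x) summable_on UNIV" for s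
    by (rule mean_summable[OF w bounded_steps[OF H]])
  have "\<bar>mean \<mu> ?D\<bar> \<le> mean \<mu> (\<lambda>x. 2 * (\<Sum>s<m. (step id ^^ Suc s) ?H x))"
  proof (rule abs_mean_le)
    show "(\<lambda>x. \<mu> x * (2 * (\<Sum>s<m. (step id ^^ Suc s) ?H x))) summable_on UNIV"
    proof -
      have "(\<lambda>x. \<mu> x * (\<Sum>s<m. (step id ^^ Suc s) ?H x)) summable_on UNIV"
        by (rule summable_weighted_sum) (use sH in auto)
      from summable_on_cmult_right[OF this, of 2] show ?thesis
        by (simp only: mult.left_commute)
    qed
    fix x :: "'a state"
    have "(\<Sum>s<m. (step id ^^ Suc s) ?H (0, snd x)) \<le> (\<Sum>s<m. (step id ^^ Suc s) ?H (fst x, snd x))"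
      by (intro sum_mono steps_mono_level H) (auto simp: mono_def)
    then show "\<bar>?D x\<bar> \<le> 2 * (\<Sum>s<m. (step id ^^ Suc s) ?H x)"
      using steps_truncation_diff[of f, OF f, of m "(0, snd x)" n] unfolding prod.collapse by linarith
  qed (use weights_nonneg[OF w] in auto)
  also have "\<dots> = 2 * real m * mean \<mu> ?H"
    unfolding mean_cmult
    by (subst mean_sum) (use sH invariant_steps[OF inv H] in \<open>auto simp del: funpow.simps\<close>)
  also have "\<dots> \<le> 2 * real m * (b / (1 - \<gamma>) * (\<Sum>i\<in>UNIV. 1 / v (n, i)))"
    by (intro mult_left_mono invariant_tail inv) auto
  finally show ?thesis
    using mean_marginal[OF w, of "\<lambda>i. (step id ^^ m) f (0, i) - (step (min n) ^^ m) f (0, i)"]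
    by simp
qed

text \<open>The sign of the difference is a test function attaining the distance. The triangle
  inequality through the two \<open>m\<close>-step means from level 0 yields two convergence errors
  and one truncation error.\<close>

lemma truncation_error:
  assumes inv: "invariant id \<mu>" "invariant (min n) \<nu>" and irr: "irreducible_matrix phase_matrix"
  shows "(\<Sum>\<^sub>\<infinity>x\<in>UNIV. \<bar>\<nu> x - \<mu> x\<bar>)
    \<le> b / (1 - \<gamma>) * (4 * \<gamma> ^ m + 2 * real m * (\<Sum>i\<in>UNIV. 1 / v (n, i)))"
proof -
  define f where "f x = sgn (\<nu> x - \<mu> x)" for x
  have f: "\<bar>f x\<bar> \<le> 1" for x by (simp add: f_def sgn_if)
  then have bf: "bounded (range f)" by (rule bounded_rangeI)
  have w: "weights \<mu>" "weights \<nu>" using inv by (auto simp: invariant_def)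
  let ?S = "\<Sum>i\<in>UNIV. 1 / v (n, i)"
  let ?p = "marginal \<mu>" and ?g = "(step id ^^ m) f" and ?g' = "(step (min n) ^^ m) f"
  have "\<bar>\<nu> x - \<mu> x\<bar> = \<nu> x * f x + - (\<mu> x * f x)" for x
    by (simp add: f_def sgn_if algebra_simps)
  then have "(\<Sum>\<^sub>\<infinity>x\<in>UNIV. \<bar>\<nu> x - \<mu> x\<bar>) = mean \<nu> f - mean \<mu> f"
    using infsum_add[OF mean_summable[OF w(2) bf] summable_on_uminus[THEN iffD2, OF mean_summable[OF w(1) bf]]]
    by (simp add: mean_def infsum_uminus)
  moreover have "\<bar>mean \<mu> f - (\<Sum>i\<in>UNIV. ?p i * ?g (0, i))\<bar> \<le> 2 * \<gamma> ^ m * (b / (1 - \<gamma>))"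
    using invariant_convergence[of _ _ f, OF inv(1) f, of m] by (simp add: mono_def)
  \<comment> \<open>Convergence of the truncated walk involves \<open>marginal \<nu>\<close>;
    uniqueness of the phase marginal turns it into \<open>?p\<close>.\<close>
  moreover have "\<bar>mean \<nu> f - (\<Sum>i\<in>UNIV. ?p i * ?g' (0, i))\<bar> \<le> 2 * \<gamma> ^ m * (b / (1 - \<gamma>))"
    using invariant_convergence[of _ _ f, OF inv(2) f, of m] marginal_unique[OF irr inv]
    by (simp add: mono_def min.coboundedI2)
  moreover have "\<bar>(\<Sum>i\<in>UNIV. ?p i * ?g (0, i)) - (\<Sum>i\<in>UNIV. ?p i * ?g' (0, i))\<bar>
      \<le> 2 * real m * (b / (1 - \<gamma>) * ?S)"
    using invariant_truncation_diff[of _ f, OF inv(1) f, of m n]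
    by (simp only: right_diff_distrib sum_subtractf)
  moreover have "b / (1 - \<gamma>) * (4 * \<gamma> ^ m + 2 * real m * ?S)
      = 2 * (2 * \<gamma> ^ m * (b / (1 - \<gamma>))) + 2 * real m * (b / (1 - \<gamma>) * ?S)"
    by (simp add: algebra_simps)
  ultimately show ?thesis by linarith
qed

end

section \<open>Reindexing of sums, and the truncation as an image of \<open>P\<close>\<close>

text \<open>Levels drop by at most one per step, so \<open>t = k + 1\<close> indexes by naturals
  every increment \<open>k\<close> that can carry mass.\<close>

lemma infsum_int_shift:
  fixes f :: "int \<Rightarrow> real"
  assumes "\<And>k. k \<le> -2 \<Longrightarrow> f k = 0"
  shows "infsum f UNIV = (\<Sum>\<^sub>\<infinity>t\<in>UNIV. f (int t - 1))"
proof -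
  have inj: "inj (\<lambda>t. int t - 1)" by (auto simp: inj_on_def)
  have "infsum f UNIV = infsum f (range (\<lambda>t. int t - 1))"
  proof (rule infsum_cong_neutral)
    fix k assume k: "k \<in> UNIV - range (\<lambda>t. int t - 1)"
    have "k \<le> -2"
    proof (rule ccontr)
      assume "\<not> k \<le> -2"
      then have "k = int (nat (k + 1)) - 1" by simp
      with k show False by blast
    qed
    then show "f k = 0" by (rule assms)
  qed auto
  also have "\<dots> = (\<Sum>\<^sub>\<infinity>t\<in>UNIV. f (int t - 1))"
    using infsum_reindex[OF inj, of f] by (simp add: o_def)
  finally show ?thesis .
qed

lemma state_sum:
  fixes q :: "'d::finite state \<Rightarrow> real"
  assumes "\<And>j. (\<lambda>t. q (t, j)) summable_on UNIV"
  shows summable_on_state: "q summable_on UNIV"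
    and infsum_state: "infsum q UNIV = (\<Sum>j\<in>UNIV. \<Sum>\<^sub>\<infinity>t\<in>UNIV. q (t, j))"
proof -
  let ?R = "\<lambda>j::'d. range (\<lambda>t::nat. (t, j))"
  have inj: "inj (\<lambda>t::nat. (t, j))" for j :: 'd by (auto simp: inj_on_def)
  have D: "?R j \<inter> ?R j' = {}" if "j \<noteq> j'" for j j' using that by auto
  have U: "(\<Union>j\<in>UNIV. ?R j) = UNIV" by auto
  have s: "q summable_on ?R j" for j
    using assms[of j] summable_on_reindex[OF inj[of j], of q] by (simp add: o_def)
  have e: "infsum q (?R j) = (\<Sum>\<^sub>\<infinity>t\<in>UNIV. q (t, j))" for j
    using infsum_reindex[OF inj[of j], of q] by (simp add: o_def)
  show "q summable_on UNIV"
    unfolding U[symmetric] by (rule summable_on_finite_union_disjoint) (simp_all add: s D)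
  show "infsum q UNIV = (\<Sum>j\<in>UNIV. \<Sum>\<^sub>\<infinity>t\<in>UNIV. q (t, j))"
    unfolding U[symmetric] e[symmetric] by (rule sum_infsum[symmetric]) (simp_all add: s D)
qed

text \<open>The fibre of a state under the cap is a singleton below level \<open>n\<close>, a whole
  ray at \<open>n\<close> and empty above.\<close>

lemma LCBA_truncation_pushforward:
  fixes P :: "'d state \<Rightarrow> 'd state \<Rightarrow> real"
  shows "LCBA_truncation n P x = (\<lambda>y. \<Sum>\<^sub>\<infinity>z\<in>(\<lambda>z. (min n (fst z), snd z)) -` {y}. P x z)"
proof
  fix y :: "'d state"
  obtain k i l j where x: "x = (k, i)" and y: "y = (l, j)" by fastforce
  let ?h = "\<lambda>z :: 'd state. (min n (fst z), snd z)"
  consider "l < n" | "l = n" | "n < l" by linarith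
  then show "LCBA_truncation n P x y = (\<Sum>\<^sub>\<infinity>z\<in>?h -` {y}. P x z)"
  proof cases
    case 1
    then have "?h -` {y} = {(l, j)}" by (auto simp: y)
    then show ?thesis using 1 by (simp add: x y)
  next
    case 2
    then have eq: "?h -` {y} = (\<lambda>m. (m, j)) ` {n..}" by (auto simp: y image_iff)
    have "(\<Sum>\<^sub>\<infinity>z\<in>?h -` {y}. P x z) = (\<Sum>\<^sub>\<infinity>m\<in>{n..}. P x (m, j))"
      unfolding eq by (subst infsum_reindex) (auto simp: inj_on_def o_def)
    then show ?thesis using 2 by (simp add: x y)
  next
    case 3
    then have "?h -` {y} = {}" by (auto simp: y)
    then show ?thesis using 3 by (simp add: x y)
  qed
qed

section \<open>The block-structured chain as a level walk\<close>

text \<open>In \<open>P_eq\<close> the truncated \<open>k - 1\<close> treats level 0 like level 1,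
  so one formula covers the boundary row and the interior rows.\<close>

locale skip_free =
  fixes P :: "'d::finite state \<Rightarrow> 'd state \<Rightarrow> real" and A :: "int \<Rightarrow> real^'d^'d"
  assumes P_weights: "weights (P x)"
    and P_eq: "P (k, i) (l, j) = (if k - 1 \<le> l then A (int l - int (k - 1) - 1) $ i $ j else 0)"
    and A_eq_0: "z \<le> -2 \<Longrightarrow> A z = 0"
begin

text \<open>From level 0 the new level is the increment itself, so row \<open>(0, i)\<close> is the
  increment law in phase \<open>i\<close>.\<close>

sublocale level_walk "\<lambda>i. P (0, i)"
  by unfold_locales (rule P_weights)

lemma P_0: "P (0, i) (t, j) = A (int t - 1) $ i $ j"
  by (simp add: P_eq)

text \<open>Row \<open>(k, i)\<close> is row \<open>(0, i)\<close> shifted up by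
  \<open>k - 1\<close> levels, and it vanishes off the range of the shift.\<close>

lemma step_id: "step id f x = mean (P x) f"
proof -
  obtain k i where x: "x = (k, i)" by fastforce
  let ?h = "\<lambda>y :: 'd state. (k - 1 + fst y, snd y)"
  have inj: "inj ?h" by (auto simp: inj_on_def prod_eq_iff)
  have "mean (P x) f = infsum (\<lambda>y. P x y * f y) (range ?h)"
    unfolding mean_def
  proof (rule infsum_cong_neutral)
    fix y assume y: "y \<in> UNIV - range ?h"
    have "\<not> k - 1 \<le> fst y"
    proof
      assume "k - 1 \<le> fst y"
      then have "y = ?h (fst y - (k - 1), snd y)" by simp
      with y show False by blast
    qed
    then have "P x y = 0" using P_eq[of k i "fst y" "snd y"] by (simp add: x)
    then show "P x y * f y = 0" by simp
  qed auto
  also have "\<dots> = (\<Sum>\<^sub>\<infinity>y\<in>UNIV. P (k, i) (?h y) * f (?h y))"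
    by (subst infsum_reindex[OF inj]) (simp add: x o_def)
  also have "\<dots> = step id f x"
    unfolding step_def mean_def x fst_conv snd_conv id_apply
  proof (rule infsum_cong)
    show "P (k, i) (?h y) * f (?h y) = P (0, i) y * f (?h y)" for y
      using P_0[of i "fst y" "snd y"] by (simp add: P_eq)
  qed
  finally show ?thesis ..
qed

lemma step_min:
  assumes "bounded (range f)"
  shows "step (min n) f x = mean (LCBA_truncation n P x) f"
proof -
  have "step (min n) f x = step id (\<lambda>y. f (min n (fst y), snd y)) x"
    by (simp add: step_def)
  also have "\<dots> = mean (LCBA_truncation n P x) f"
    using mean_pushforward[OF P_weights assms, of x "\<lambda>z. (min n (fst z), snd z)"]
    by (simp add: step_id LCBA_truncation_pushforward)
  finally show ?thesis .
qed

lemma invariant_id: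
  assumes "stationary_distribution P \<mu>"
  shows "invariant id \<mu>"
proof -
  have "step id f = (\<lambda>x. mean (P x) f)" for f by (simp add: fun_eq_iff step_id)
  then show ?thesis
    using assms stationary_mean[OF P_weights assms]
    by (simp add: invariant_def weights_def stationary_distribution_def)
qed

lemma invariant_min:
  assumes "stationary_distribution (LCBA_truncation n P) \<mu>"
  shows "invariant (min n) \<mu>"
proof -
  have "weights (LCBA_truncation n P x)" for x
    unfolding LCBA_truncation_pushforward by (rule weights_pushforward[OF P_weights])
  then have "mean \<mu> (step (min n) f) = mean \<mu> f" if "bounded (range f)" for f
    unfolding ext[OF step_min[OF that]] using assms that by (rule stationary_mean)
  then show ?thesis
    using assms by (simp add: invariant_def weights_def stationary_distribution_def)
qed

lemma phase_matrix_eq: "phase_matrix i j = (\<Sum>\<^sub>\<infinity>k\<in>UNIV. A k $ i $ j)"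
proof -
  let ?q = "\<lambda>y :: 'd state. P (0, i) y * of_bool (snd y = j)"
  have inj: "inj (\<lambda>t::nat. (t, j))" by (auto simp: inj_on_def)
  have "phase_matrix i j = infsum ?q (range (\<lambda>t. (t, j)))"
    unfolding phase_matrix_def mean_def by (rule infsum_cong_neutral) auto
  also have "\<dots> = (\<Sum>\<^sub>\<infinity>t\<in>UNIV. A (int t - 1) $ i $ j)"
    by (subst infsum_reindex[OF inj]) (simp add: o_def P_0)
  also have "\<dots> = (\<Sum>\<^sub>\<infinity>k\<in>UNIV. A k $ i $ j)"
    by (rule infsum_int_shift[symmetric]) (simp add: A_eq_0)
  finally show ?thesis .
qed

lemma power_summable:
  assumes "1 < \<alpha>" "ereal \<alpha> < r_plus A"
  shows "(\<lambda>t. P (0, i) (t, j) * \<alpha> ^ t) summable_on UNIV"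
proof -
  obtain z where z: "\<alpha> < z" and sz: "summable (\<lambda>k. z ^ k * A (int k) $ i $ j)"
    using assms(2) by (auto simp: r_plus_def less_Sup_iff)
  have nn: "0 \<le> P (0, i) (t, j)" for t by (rule weights_nonneg[OF P_weights])
  \<comment> \<open>\<open>r_plus\<close> concerns only \<open>A k\<close> with nonnegative
    \<open>k\<close>. The shift sets aside the single term \<open>t = 0\<close>, an entry of
    \<open>A (- 1)\<close>; the extra factor \<open>\<alpha>\<close> comes from
    \<open>t = k + 1\<close>.\<close>
  have "summable (\<lambda>k. P (0, i) (Suc k, j) * \<alpha> ^ Suc k)"
  proof (rule summable_comparison_test')
    show "summable (\<lambda>k. \<alpha> * (z ^ k * A (int k) $ i $ j))" by (rule summable_mult[OF sz])
    show "norm (P (0, i) (Suc k, j) * \<alpha> ^ Suc k) \<le> \<alpha> * (z ^ k * A (int k) $ i $ j)" for k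
    proof -
      have A0: "0 \<le> A (int k) $ i $ j" using nn[of "Suc k"] by (simp add: P_0)
      have "\<alpha> ^ k * A (int k) $ i $ j \<le> z ^ k * A (int k) $ i $ j"
        using z assms(1) A0 by (intro mult_right_mono power_mono) auto
      then have "\<alpha> * (\<alpha> ^ k * A (int k) $ i $ j) \<le> \<alpha> * (z ^ k * A (int k) $ i $ j)"
        using assms(1) by (intro mult_left_mono) auto
      then show ?thesis using A0 assms(1) by (simp add: P_0 abs_mult mult_ac)
    qed
  qed
  then have "summable (\<lambda>t. P (0, i) (t, j) * \<alpha> ^ t)" by (rule summable_Suc_iff[THEN iffD1])
  then show ?thesis
    using nn assms(1) by (subst summable_on_UNIV_nonneg_real_iff) auto
qed

lemma A_hat_eq:
  assumes "0 < \<alpha>"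
  shows "\<alpha> * A_hat A \<alpha> $ i $ j = (\<Sum>\<^sub>\<infinity>t\<in>UNIV. P (0, i) (t, j) * \<alpha> ^ t)"
proof -
  have "A_hat A \<alpha> $ i $ j = (\<Sum>\<^sub>\<infinity>t\<in>UNIV. \<alpha> powi (int t - 1) * A (int t - 1) $ i $ j)"
    unfolding A_hat_def vec_lambda_beta by (rule infsum_int_shift) (simp add: A_eq_0)
  also have "\<alpha> * \<dots> = (\<Sum>\<^sub>\<infinity>t\<in>UNIV. P (0, i) (t, j) * \<alpha> ^ t)"
    using assms by (simp add: infsum_cmult_right'[symmetric] P_0 power_int_diff mult_ac)
  finally show ?thesis .
qed

text \<open>The weight at level \<open>k + t\<close> is \<open>\<alpha> ^ Suc k\<close> times the
  power \<open>t - 1\<close> of \<open>\<alpha>\<close>, so the mean rebuilds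
  \<open>A_hat A \<alpha> *v w\<close> and the eigenvector equation gives the drift with
  equality.\<close>

lemma geometric_drift:
  assumes \<alpha>: "1 < \<alpha>" "ereal \<alpha> < r_plus A" and w: "A_hat A \<alpha> *v w = \<gamma> *\<^sub>R w"
  shows "(\<lambda>y. P (0, i) y * (\<alpha> ^ (k + fst y) * w $ snd y)) summable_on UNIV"
    and "mean (P (0, i)) (\<lambda>y. \<alpha> ^ (k + fst y) * w $ snd y) = \<gamma> * (\<alpha> ^ Suc k * w $ i)"
proof -
  let ?q = "\<lambda>y. P (0, i) y * (\<alpha> ^ (k + fst y) * w $ snd y)"
  have q: "?q (t, j) = P (0, i) (t, j) * \<alpha> ^ t * (\<alpha> ^ k * w $ j)" for t j
    by (simp add: power_add mult_ac)
  have s: "(\<lambda>t. ?q (t, j)) summable_on UNIV" for j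
    unfolding q by (rule summable_on_cmult_left[OF power_summable[OF \<alpha>]])
  show "?q summable_on UNIV" by (rule summable_on_state[OF s])
  have "mean (P (0, i)) (\<lambda>y. \<alpha> ^ (k + fst y) * w $ snd y)
      = (\<Sum>j\<in>UNIV. \<alpha> * A_hat A \<alpha> $ i $ j * (\<alpha> ^ k * w $ j))"
    unfolding mean_def infsum_state[OF s] unfolding q
    using \<alpha>(1) by (simp add: infsum_cmult_left' A_hat_eq)
  also have "\<dots> = \<alpha> ^ Suc k * (A_hat A \<alpha> *v w) $ i"
    by (simp add: matrix_vector_mult_def sum_distrib_left mult_ac)
  also have "\<dots> = \<gamma> * (\<alpha> ^ Suc k * w $ i)" by (simp add: w)
  finally show "mean (P (0, i)) (\<lambda>y. \<alpha> ^ (k + fst y) * w $ snd y) = \<gamma> * (\<alpha> ^ Suc k * w $ i)" .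
qed

lemma A_hat_nonneg:
  assumes "0 < \<alpha>"
  shows "0 \<le> A_hat A \<alpha> $ i $ j"
proof -
  have "0 \<le> \<alpha> * A_hat A \<alpha> $ i $ j"
    unfolding A_hat_eq[OF assms] using assms
    by (intro infsum_nonneg mult_nonneg_nonneg weights_nonneg[OF P_weights]) auto
  then show ?thesis using assms by (simp add: zero_le_mult_iff)
qed

end

theorem theorem5p2:
  fixes P :: "'d::finite state \<Rightarrow> 'd state \<Rightarrow> real"
    and A B :: "int \<Rightarrow> real^'d^'d"
    and \<pi> :: "'d state \<Rightarrow> real"
    and \<pi>n :: "nat \<Rightarrow> 'd state \<Rightarrow> real"
    and v\<^sub>A :: "real^'d"
    and v :: "'d state \<Rightarrow> real"
    and \<alpha> \<gamma> b :: real
  assumes "stochastic P"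
    and "block_form P A B"
    and "block_monotone P"
    and "irreducible_matrix P" and "positive_recurrent P"
    and "stationary_distribution P \<pi>"
    and "irreducible_matrix (\<lambda>i j. \<Sum>\<^sub>\<infinity>k\<in>UNIV. A k $ i $ j)"
    and "stochastic (\<lambda>i j. \<Sum>\<^sub>\<infinity>k\<in>UNIV. A k $ i $ j)"
    and "1 < r_plus A"
    and "\<And>k::int. 2 \<le> k \<Longrightarrow> B (- k) = 0" and "\<And>k::int. 2 \<le> k \<Longrightarrow> A (- k) = 0"
    and "B (- 1) = A (- 1)"
    and "\<And>k::int. 0 \<le> k \<Longrightarrow> B k = A (k - 1)"
    and "\<And>n. 1 \<le> n \<Longrightarrow> stationary_distribution (LCBA_truncation n P) (\<pi>n n)"
    and "1 < \<alpha>" and "ereal \<alpha> < r_plus A" and "delta A \<alpha> < 1"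
    and "normalized_PF_vector A \<alpha> v\<^sub>A"
    and "\<gamma> = delta A \<alpha>"
    and "b = (\<alpha> - 1) * (MAX i. v\<^sub>A $ i)"
    and "\<And>k i. v (k, i) = \<alpha> ^ k * v\<^sub>A $ i"
  shows "\<forall>n\<ge>1. \<forall>m\<ge>1.
    (\<Sum>\<^sub>\<infinity>x\<in>UNIV. \<bar>\<pi>n n x - \<pi> x\<bar>)
      \<le> b / (1 - \<gamma>) * (4 * \<gamma> ^ m + 2 * real m * (\<Sum>i\<in>UNIV. 1 / v (n, i)))"
proof -
  note P_stochastic = assms(1) and blocks = assms(2)[unfolded block_form_def]
    and B_low = assms(10) and A_low = assms(11) and B_1 = assms(12) and B_up = assms(13)
    and \<alpha> = assms(15,16) and v_def = assms(21)
  have vA: "A_hat A \<alpha> *v v\<^sub>A = \<gamma> *\<^sub>R v\<^sub>A" and vA1: "1 \<le> v\<^sub>A $ i" for i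
    using assms(18,19) by (auto simp: normalized_PF_vector_def)
  interpret skip_free P A
  proof
    show "weights (P x)" for x
      using P_stochastic unfolding stochastic_def weights_def by blast
    show A0: "A k = 0" if "k \<le> -2" for k using A_low[of "- k"] that by simp
    show "P (k, i) (l, j) = (if k - 1 \<le> l then A (int l - int (k - 1) - 1) $ i $ j else 0)" for k i l j
    proof (cases "k = 0")
      case True
      then show ?thesis using blocks B_up by simp
    next
      case k: False
      show ?thesis
      proof (cases "l = 0")
        case True
        then have "P (k, i) (l, j) = B (- int k) $ i $ j" using blocks k by simp
        \<comment> \<open>In column 0 the entry is that of \<open>A (- 1)\<close> for
          \<open>k = 1\<close>, and zero for larger \<open>k\<close>, where
          \<open>k - 1 \<le> l\<close> fails.\<close>
        then show ?thesis using True k B_1 B_low[of "int k"] by (cases "k = 1") auto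
      next
        case False
        then have "P (k, i) (l, j) = A (int l - int k) $ i $ j" using blocks k by simp
        then show ?thesis using k A0[of "int l - int k"] by (auto simp: of_nat_diff)
      qed
    qed
  qed
  \<comment> \<open>A nonnegative matrix maps the positive eigenvector to a nonnegative vector. The
    description operator in \<open>PF_eigenvalue\<close> thus need not be resolved.\<close>
  have \<gamma>0: "0 \<le> \<gamma>"
  proof -
    fix i :: 'd
    have "0 \<le> (\<Sum>j\<in>UNIV. A_hat A \<alpha> $ i $ j * v\<^sub>A $ j)"
      using A_hat_nonneg[of \<alpha>] \<alpha>(1) vA1
      by (intro sum_nonneg mult_nonneg_nonneg) (auto intro: order_trans[OF zero_le_one])
    also have "\<dots> = \<gamma> * v\<^sub>A $ i"
      using arg_cong[OF vA, of "\<lambda>x. x $ i"] by (simp add: matrix_vector_mult_def)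
    finally show ?thesis using vA1[of i] by (simp add: zero_le_mult_iff)
  qed
  have Max: "v\<^sub>A $ i \<le> (MAX i. v\<^sub>A $ i)" for i by simp
  have b: "(\<alpha> - 1) * v\<^sub>A $ i \<le> b" for i
    unfolding assms(20) using \<alpha>(1) by (intro mult_left_mono Max) auto
  have vA0: "0 \<le> v\<^sub>A $ i" for i using vA1[of i] by linarith
  have v_eq: "v y = \<alpha> ^ fst y * v\<^sub>A $ snd y" for y by (metis prod.collapse v_def)
  interpret drift_walk "\<lambda>i. P (0, i)" v \<gamma> b
  proof
    fix i :: 'd and k :: nat
    show "mean (P (0, i)) (\<lambda>y. v (k + fst y, snd y)) \<le> \<gamma> * v (Suc k, i)"
      using geometric_drift(2)[OF \<alpha> vA, of i k] by (simp add: v_def)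
    show "(\<lambda>y. P (0, i) y * v (k + fst y, snd y)) summable_on UNIV"
      using geometric_drift(1)[OF \<alpha> vA, of i k] by (simp add: v_def)
    have "mean (P (0, i)) v = \<gamma> * (\<alpha> * v\<^sub>A $ i)"
      using geometric_drift(2)[OF \<alpha> vA, of i 0] by (simp add: v_eq[abs_def])
    \<comment> \<open>Level 0 moves like level 1, hence the factor \<open>\<alpha>\<close>. The
      excess over \<open>\<gamma> * v (0, i)\<close> is what \<open>b\<close> absorbs, since
      \<open>\<gamma>\<close> is below 1.\<close>
    also have "\<dots> = \<gamma> * v\<^sub>A $ i + \<gamma> * ((\<alpha> - 1) * v\<^sub>A $ i)" by (simp add: algebra_simps)
    also have "\<gamma> * ((\<alpha> - 1) * v\<^sub>A $ i) \<le> 1 * ((\<alpha> - 1) * v\<^sub>A $ i)"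
      using assms(17,19) \<alpha>(1) vA0 by (intro mult_right_mono) auto
    finally show "mean (P (0, i)) v \<le> \<gamma> * v (0, i) + b" using b[of i] by (simp add: v_def)
    show "v (k, i) \<le> v (l, i)" if "k \<le> l" for l
      unfolding v_def using that \<alpha>(1) vA0 by (intro mult_right_mono power_increasing) auto
    show "1 \<le> v x" for x
      unfolding v_eq using \<alpha>(1) vA1 mult_mono[of 1 "\<alpha> ^ fst x" 1 "v\<^sub>A $ snd x"] by simp
    show "0 \<le> b" using b[of i] \<alpha>(1) vA0[of i] by (smt (verit) mult_nonneg_nonneg)
  qed (use \<gamma>0 assms(17,19) in auto)
  have "phase_matrix = (\<lambda>i j. \<Sum>\<^sub>\<infinity>k\<in>UNIV. A k $ i $ j)"
    by (intro ext phase_matrix_eq)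
  then have irr: "irreducible_matrix phase_matrix" using assms(7) by simp
  show ?thesis
    by (intro allI impI truncation_error invariant_id invariant_min assms(6,14) irr)
qed

end
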